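(* Let $D=\|d_{ij}\|_{i,j=1}^\infty$ be a complex $p$-banded matrix, let $$q:=\sup_{n\ge1}q_n,\qquad Q_0:=\sum_{k=1}^\infty q_k,\qquad Q_1:=\sum_{k=1}^\infty kq_k,$$ and let $t\approx0.567$ be the unique real root of $te^t=1$. Assume that $Q_0<\infty$ and $q<1$. Then the domain $G(D)=\{z+z^{-1}:\ z\in\Omega\}$, with $$\Omega:=\Bigl\{z\in\mathbb{D}\setminus\{0\}:\ |z-z^{-1}|>\frac{8Q_0}{t}\exp\Bigl\{\frac{2-q}{1-q}\,Q_0\Bigr\}\Bigr\},$$ is free from the discrete spectrum, i.e. $G(D)\cap\sigma_{\rm d}(D)=\emptyset$. Moreover, assume in addition that $Q_1<\infty$. Then $D$ has no discrete spectrum (i.e. $\sigma_{\rm d}(D)=\emptyset$) as long as $$\exp\Bigl\{\frac{2-q}{1-q}\,Q_0\Bigr\}\,Q_1<\frac{t}{4}.$$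
   Context: $\mathbb{D}$ is the open unit disk. A complex matrix $D=\|d_{ij}\|_{i,j=1}^\infty$ is banded of order $p$ ($p$-banded) if $d_{ij}=0$ for $|i-j|>p$ and $d_{ij}\ne0$ for $|i-j|=p$. By convention, for indices with $\min(i,j)\le 0$ one sets $d_{ij}=1$ if $|i-j|=p$ and $d_{ij}=0$ if $|i-j|\neq p$. For $n\ge1$, $$q_n:=|d_{n,n-p}-1|+\sum_{r=-p+1}^{p-1}|d_{n,n+r}|+|d_{n,n+p}-1|.$$ When $\sum q_n<\infty$, $D$ defines a bounded operator on $\ell^2(\mathbb{N})$ which is a compact perturbation of $D_0=S^p+(S^* )^p$ ($S$ the one-sided shift), and $\sigma(D_0)=[-2,2]$; hence $\sigma(D)=[-2,2]\cup\sigma_{\rm d}(D)$, where the discrete spectrum $\sigma_{\rm d}(D)$ is the at most countable set of eigenvalues (of finite algebraic multiplicity) of $D$ in $\mathbb{C}\setminus[-2,2]$. *)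

theory Defs
  imports "HOL-Analysis.Analysis" "HOL-Library.Function_Algebras"
begin

text \<open>Matrices \<open>d\<close> and sequences \<open>x\<close> are indexed from 1, as functions on \<open>nat\<close>. Entries of \<open>d\<close> with a
  zero index are never used; sequences in \<open>l2\<close> are required to vanish at index 0, so that \<open>l2\<close> is
  the space of square-summable sequences on the positive integers.\<close>

definition banded :: "nat \<Rightarrow> (nat \<Rightarrow> nat \<Rightarrow> complex) \<Rightarrow> bool" where
  "banded p d \<longleftrightarrow> (\<forall>i\<ge>1. \<forall>j\<ge>1.
     (\<bar>int i - int j\<bar> > int p \<longrightarrow> d i j = 0) \<and> (\<bar>int i - int j\<bar> = int p \<longrightarrow> d i j \<noteq> 0))"

definition ext_entry :: "nat \<Rightarrow> (nat \<Rightarrow> nat \<Rightarrow> complex) \<Rightarrow> int \<Rightarrow> int \<Rightarrow> complex" where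
  "ext_entry p d i j =
     (if min i j \<le> 0 then (if \<bar>i - j\<bar> = int p then 1 else 0) else d (nat i) (nat j))"

definition qrow :: "nat \<Rightarrow> (nat \<Rightarrow> nat \<Rightarrow> complex) \<Rightarrow> nat \<Rightarrow> real" where
  "qrow p d n =
     cmod (ext_entry p d (int n) (int n - int p) - 1)
     + (\<Sum>r = - int p + 1..int p - 1. cmod (ext_entry p d (int n) (int n + r)))
     + cmod (ext_entry p d (int n) (int n + int p) - 1)"

definition qsup :: "nat \<Rightarrow> (nat \<Rightarrow> nat \<Rightarrow> complex) \<Rightarrow> real" where
  "qsup p d = (SUP n\<in>{1..}. qrow p d n)"

definition Q0 :: "nat \<Rightarrow> (nat \<Rightarrow> nat \<Rightarrow> complex) \<Rightarrow> real" where
  "Q0 p d = (\<Sum>\<^sub>\<infinity>k\<in>{1..}. qrow p d k)"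

definition Q1 :: "nat \<Rightarrow> (nat \<Rightarrow> nat \<Rightarrow> complex) \<Rightarrow> real" where
  "Q1 p d = (\<Sum>\<^sub>\<infinity>k\<in>{1..}. real k * qrow p d k)"

definition l2 :: "(nat \<Rightarrow> complex) set" where
  "l2 = {x. x 0 = 0 \<and> (\<lambda>n. (cmod (x n))\<^sup>2) summable_on {1..}}"

text \<open>For a banded matrix the sum below has only finitely many nonzero terms.\<close>

definition mat_op :: "(nat \<Rightarrow> nat \<Rightarrow> complex) \<Rightarrow> (nat \<Rightarrow> complex) \<Rightarrow> nat \<Rightarrow> complex" where
  "mat_op d x = (\<lambda>i. if i = 0 then 0 else (\<Sum>\<^sub>\<infinity>j\<in>{1..}. d i j * x j))"

definition seq_scale :: "complex \<Rightarrow> (nat \<Rightarrow> complex) \<Rightarrow> nat \<Rightarrow> complex" where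
  "seq_scale c x = (\<lambda>n. c * x n)"

global_interpretation cseq: vector_space seq_scale
  by unfold_locales (auto simp: seq_scale_def fun_eq_iff algebra_simps)

definition is_eigenvalue :: "(nat \<Rightarrow> nat \<Rightarrow> complex) \<Rightarrow> complex \<Rightarrow> bool" where
  "is_eigenvalue d w \<longleftrightarrow> (\<exists>x\<in>l2. x \<noteq> 0 \<and> mat_op d x = seq_scale w x)"

definition root_space :: "(nat \<Rightarrow> nat \<Rightarrow> complex) \<Rightarrow> complex \<Rightarrow> (nat \<Rightarrow> complex) set" where
  "root_space d w = {x\<in>l2. \<exists>k. ((\<lambda>y. mat_op d y - seq_scale w y) ^^ k) x = 0}"

text \<open>The algebraic multiplicity of an eigenvalue is the dimension of its root space.\<close>

definition finite_alg_mult :: "(nat \<Rightarrow> nat \<Rightarrow> complex) \<Rightarrow> complex \<Rightarrow> bool" where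
  "finite_alg_mult d w \<longleftrightarrow> (\<exists>B. finite B \<and> root_space d w \<subseteq> cseq.span B)"

definition discrete_spectrum :: "(nat \<Rightarrow> nat \<Rightarrow> complex) \<Rightarrow> complex set" where
  "discrete_spectrum d =
     {w. w \<notin> complex_of_real ` {-2..2} \<and> is_eigenvalue d w \<and> finite_alg_mult d w}"

definition t_root :: real where
  "t_root = (THE t. t * exp t = 1)"

lemma t_root_ex1: "\<exists>!t::real. t * exp t = 1"
proof -
  have "\<exists>t\<ge>0. t \<le> 1 \<and> t * exp t = (1::real)"
    by (rule IVT') (auto intro!: continuous_intros)
  moreover have "s = t" if "s * exp s = 1" "t * exp t = 1" for s t :: real
  proof -
    have pos: "s > 0" "t > 0"
      using that by (metis exp_gt_zero zero_less_mult_pos2 zero_less_one)+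
    have "x * exp x < y * exp y" if "x < y" "0 < x" for x y :: real
      using that by (intro mult_strict_mono) auto
    then show ?thesis
      using pos that by (metis less_irrefl linorder_neqE_linordered_idom)
  qed
  ultimately show ?thesis by blast
qed

definition Omega :: "nat \<Rightarrow> (nat \<Rightarrow> nat \<Rightarrow> complex) \<Rightarrow> complex set" where
  "Omega p d = {z \<in> ball 0 1 - {0}.
     cmod (z - inverse z)
       > 8 * Q0 p d / t_root * exp ((2 - qsup p d) / (1 - qsup p d) * Q0 p d)}"

definition G_domain :: "nat \<Rightarrow> (nat \<Rightarrow> nat \<Rightarrow> complex) \<Rightarrow> complex set" where
  "G_domain p d = {z + inverse z | z. z \<in> Omega p d}"

end

theory Submission
  imports Defs
begin

text \<open>
  An eigenvector \<open>x\<close> of \<open>D\<close> for \<open>w = z + 1/z\<close> satisfies \<open>(D\<^sub>0 - w) x = f\<close> with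
  \<open>\<bar>f\<^sub>n\<bar> \<le> q\<^sub>n \<parallel>x\<parallel>\<^sub>\<infinity>\<close>. Along each residue class modulo \<open>p\<close> this is the scalar recurrence
  \<open>y\<^sub>k\<^sub>+\<^sub>1 + y\<^sub>k\<^sub>-\<^sub>1 - w y\<^sub>k = f\<^sub>k\<close> with \<open>y\<^sub>0 = 0\<close>, which factors through the first-order recurrences
  for \<open>b\<^sub>k = y\<^sub>k\<^sub>+\<^sub>1 - z y\<^sub>k\<close> and \<open>c\<^sub>k = y\<^sub>k\<^sub>+\<^sub>1 - y\<^sub>k/z\<close>. Solving the former backwards from infinity and the
  latter forwards from \<open>c\<^sub>0 = b\<^sub>0\<close> gives \<open>\<bar>z - 1/z\<bar> \<bar>y\<^sub>k\<bar> = \<bar>c\<^sub>k - b\<^sub>k\<bar> \<le> 2 \<Sum>\<bar>f\<^sub>n\<bar>\<close>, and summing the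
  bounds for \<open>b\<close> gives \<open>\<bar>y\<^sub>k\<bar> \<le> \<Sum>n\<bar>f\<^sub>n\<bar>\<close>. Hence \<open>\<bar>z - 1/z\<bar> \<le> 2 Q\<^sub>0\<close> and \<open>1 \<le> Q\<^sub>1\<close> whenever \<open>x \<noteq> 0\<close>,
  which contradicts the respective hypotheses since \<open>t < 1\<close>.
\<close>

section \<open>Preimages under the Joukowski map\<close>

text \<open>The roots \<open>a\<close>, \<open>b\<close> of \<open>u^2 - w u + 1\<close> have
  product 1, so one of them lies in the open disk unless both lie on the unit circle, and then
  \<open>w = 2 Re a\<close> lies in [-2,2].\<close>

lemma Joukowski_preimage:
  fixes w :: complex
  assumes "w \<notin> complex_of_real ` {-2..2}"
  obtains z where "z \<noteq> 0" "cmod z < 1" "w = z + inverse z"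
proof -
  define s where "s = csqrt (w\<^sup>2 - 4)"
  have s2: "s * s = w * w - 4"
    using power2_csqrt[of "w\<^sup>2 - 4"] by (simp add: s_def power2_eq_square)
  define a where "a = (w + s) / 2"
  define b where "b = (w - s) / 2"
  have ab: "a * b = 1"
  proof -
    have "a * b = (w * w - s * s) / 4" by (simp add: a_def b_def algebra_simps)
    then show ?thesis by (simp add: s2)
  qed
  have sum: "a + b = w" by (simp add: a_def b_def field_simps)
  have inv: "b = inverse a" "a = inverse b" "a \<noteq> 0" "b \<noteq> 0"
    using ab by (auto simp: inverse_unique) (metis inverse_unique mult.commute)
  have "cmod a \<noteq> 1"
  proof
    assume n: "cmod a = 1"
    then have "b = cnj a"
      using complex_norm_square[of a] ab inv(3)
      by (metis mult_cancel_left of_real_1 one_power2)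
    then have "w = complex_of_real (2 * Re a)"
      using sum complex_add_cnj[of a] by simp
    moreover have "\<bar>Re a\<bar> \<le> 1" using abs_Re_le_cmod[of a] n by simp
    ultimately have "w \<in> complex_of_real ` {-2..2}"
      by (intro image_eqI[of _ _ "2 * Re a"]) (simp_all only: atLeastAtMost_iff, linarith)
    with assms show False by contradiction
  qed
  moreover have "cmod a * cmod b = 1" using ab by (metis norm_mult norm_one)
  ultimately have "cmod a < 1 \<or> cmod b < 1"
    using less_1_mult'[of "cmod a" "cmod b"] by linarith
  moreover have "w = a + inverse a" "w = b + inverse b"
    by (simp_all flip: sum inv(1,2))
  ultimately show thesis
    using that inv(3,4) by blast
qed

section \<open>The scalar second-order recurrence\<close>

text \<open>Boundedness acts as the condition at infinity and \<open>y 0 = 0\<close> as the one at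
  the origin; the value \<open>f 0\<close> is left free.\<close>

locale bounded_recurrence =
  fixes z :: complex and y f :: "nat \<Rightarrow> complex"
  assumes z0: "z \<noteq> 0" and z1: "cmod z < 1"
    and y0: "y 0 = 0" and bounded: "bounded (range y)"
    and rec: "\<And>k. y (Suc (Suc k)) + y k - (z + inverse z) * y (Suc k) = f (Suc k)"
begin

definition b where "b k = y (Suc k) - z * y k"

text \<open>The recurrence reads \<open>b (Suc k) = inverse z * b k + f (Suc k)\<close>; solved for
  \<open>b k\<close>, it contracts by \<open>z\<close>. That factor is kept on \<open>b\<close>, to
  make the remainder decay, and dropped on \<open>f\<close>.\<close>

lemma b_step: "cmod (b k) \<le> cmod (f (Suc k)) + cmod z * cmod (b (Suc k))"
proof -
  have "b k = z * (b (Suc k) - f (Suc k))"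
    using z0 by (simp add: b_def rec[symmetric] field_simps)
  then have "cmod (b k) \<le> cmod z * (cmod (f (Suc k)) + cmod (b (Suc k)))"
    by (metis norm_mult norm_triangle_ineq4 mult_left_mono norm_ge_zero add.commute)
  also have "\<dots> \<le> cmod (f (Suc k)) + cmod z * cmod (b (Suc k))"
    using z1 mult_right_mono[of "cmod z" 1 "cmod (f (Suc k))"] by (simp add: distrib_left)
  finally show ?thesis .
qed

lemma b_iterate:
  "cmod (b k) \<le> (\<Sum>n<N. cmod (f (Suc (k + n)))) + cmod z ^ N * cmod (b (k + N))"
proof (induction N)
  case (Suc N)
  have "cmod z ^ N * cmod (b (k + N))
      \<le> cmod z ^ N * (cmod (f (Suc (k + N))) + cmod z * cmod (b (Suc (k + N))))"
    by (intro mult_left_mono b_step) auto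
  also have "\<dots> \<le> cmod (f (Suc (k + N))) + cmod z ^ Suc N * cmod (b (k + Suc N))"
    using z1 mult_right_mono[of "cmod z ^ N" 1 "cmod (f (Suc (k + N)))"]
    by (simp add: algebra_simps power_le_one)
  finally show ?case using Suc by simp
qed simp

text \<open>Boundedness passes from \<open>y\<close> to \<open>b\<close>, so the geometric factor
  removes any contribution from infinity.\<close>

lemma b_remainder: "(\<lambda>N. cmod z ^ N * cmod (b (k + N))) \<longlonglongrightarrow> 0"
proof -
  obtain M where M: "\<And>n. cmod (y n) \<le> M"
    using bounded by (auto simp: bounded_iff)
  have bM: "cmod (b n) \<le> M + cmod z * M" for n
    unfolding b_def
    by (rule order_trans[OF norm_triangle_ineq4]) (simp add: norm_mult M add_mono mult_left_mono)
  have "(\<lambda>N. cmod z ^ N * (M + cmod z * M)) \<longlonglongrightarrow> 0"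
    using z1 by (intro tendsto_mult_left_zero LIMSEQ_power_zero) simp
  then show ?thesis
    by (rule Lim_null_comparison[rotated]) (use bM in \<open>auto intro!: eventuallyI mult_left_mono\<close>)
qed

lemma b_tail_bound:
  assumes "summable (\<lambda>n. cmod (f n))"
  shows "cmod (b k) \<le> (\<Sum>n. cmod (f (Suc (k + n))))"
proof -
  have "summable (\<lambda>n. cmod (f (Suc (k + n))))"
    using summable_ignore_initial_segment[OF assms, of "Suc k"] by (simp add: add.commute)
  then have "(\<lambda>N. (\<Sum>n<N. cmod (f (Suc (k + n)))) + cmod z ^ N * cmod (b (k + N)))
      \<longlonglongrightarrow> (\<Sum>n. cmod (f (Suc (k + n)))) + 0"
    by (intro tendsto_add summable_LIMSEQ b_remainder)
  then show ?thesis
    by (intro LIMSEQ_le_const[of _ "suminf _"]) (auto intro!: exI[of _ 0] b_iterate)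
qed

lemma norm_y_le_sum_b: "cmod (y k) \<le> (\<Sum>i<k. cmod (b i))"
proof (induction k)
  case (Suc k)
  have "y (Suc k) = b k + z * y k" by (simp add: b_def)
  then have "cmod (y (Suc k)) \<le> cmod (b k) + cmod z * cmod (y k)"
    by (metis norm_mult norm_triangle_ineq)
  also have "\<dots> \<le> cmod (b k) + cmod (y k)"
    using z1 by (simp add: mult_left_le_one_le)
  finally show ?case using Suc by simp
qed (simp add: y0)

text \<open>The bound for \<open>b i\<close> involves \<open>f m\<close> only for
  \<open>m > i\<close>, so after summing over \<open>i\<close> each \<open>f m\<close> is counted at
  most \<open>m\<close> times. Truncating at \<open>N\<close> keeps all sums finite until the final
  limit.\<close>

lemma first_moment_bound:
  assumes "\<And>K. (\<Sum>n<K. real n * cmod (f n)) \<le> C"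
  shows "cmod (y k) \<le> C"
proof -
  have le: "cmod (y k) \<le> C + (\<Sum>i<k. cmod z ^ N * cmod (b (i + N)))" for N
  proof -
    \<comment> \<open>A common range of \<open>m\<close>, independent of \<open>i\<close>, allows
      the two sums to be swapped.\<close>
    have "(\<Sum>i<k. \<Sum>n<N. cmod (f (Suc (i + n)))) \<le> (\<Sum>i<k. \<Sum>m<Suc (k + N). if i < m then cmod (f m) else 0)"
    proof (intro sum_mono)
      fix i assume "i \<in> {..<k}"
      have "(\<Sum>n<N. cmod (f (Suc (i + n)))) = (\<Sum>m\<in>(\<lambda>n. Suc (i + n)) ` {..<N}. cmod (f m))"
        by (subst sum.reindex) (auto simp: inj_on_def)
      also have "\<dots> = (\<Sum>m\<in>(\<lambda>n. Suc (i + n)) ` {..<N}. if i < m then cmod (f m) else 0)"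
        by (intro sum.cong) auto
      also have "\<dots> \<le> (\<Sum>m<Suc (k + N). if i < m then cmod (f m) else 0)"
        using \<open>i \<in> {..<k}\<close> by (intro sum_mono2) auto
      finally show "(\<Sum>n<N. cmod (f (Suc (i + n)))) \<le> \<dots>" .
    qed
    also have "\<dots> = (\<Sum>m<Suc (k + N). \<Sum>i<k. if i < m then cmod (f m) else 0)"
      by (rule sum.swap)
    also have "\<dots> \<le> (\<Sum>m<Suc (k + N). real m * cmod (f m))"
    proof (intro sum_mono)
      fix m
      have "(\<Sum>i<k. if i < m then cmod (f m) else 0) = real (card ({..<k} \<inter> {..<m})) * cmod (f m)"
        by (simp add: sum.If_cases lessThan_def)
      also have "\<dots> \<le> real m * cmod (f m)"
        using card_mono[of "{..<m}" "{..<k} \<inter> {..<m}"] by (intro mult_right_mono) auto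
      finally show "(\<Sum>i<k. if i < m then cmod (f m) else 0) \<le> real m * cmod (f m)" .
    qed
    also have "\<dots> \<le> C" by (rule assms)
    finally have "(\<Sum>i<k. \<Sum>n<N. cmod (f (Suc (i + n)))) \<le> C" .
    moreover have "(\<Sum>i<k. cmod (b i))
        \<le> (\<Sum>i<k. (\<Sum>n<N. cmod (f (Suc (i + n)))) + cmod z ^ N * cmod (b (i + N)))"
      by (intro sum_mono b_iterate)
    ultimately show ?thesis
      using norm_y_le_sum_b[of k] by (simp add: sum.distrib)
  qed
  have "(\<lambda>N. C + (\<Sum>i<k. cmod z ^ N * cmod (b (i + N)))) \<longlonglongrightarrow> C + (\<Sum>i<k. 0)"
    by (intro tendsto_add tendsto_const tendsto_sum b_remainder)
  then show ?thesis
    by (intro LIMSEQ_le_const[of _ C]) (auto intro!: exI[of _ 0] le)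
qed

text \<open>The complementary factor: \<open>c (Suc k) = f (Suc k) + z * c k\<close> contracts
  forwards, and \<open>c 0 = b 0\<close> because \<open>y 0 = 0\<close>.\<close>

definition c where "c k = y (Suc k) - inverse z * y k"

lemma c_bound: "cmod (c k) \<le> cmod (b 0) + (\<Sum>i<k. cmod (f (Suc i)))"
proof (induction k)
  case (Suc k)
  have "c (Suc k) = f (Suc k) + z * c k"
    using z0 by (simp add: c_def rec[symmetric] field_simps)
  then have "cmod (c (Suc k)) \<le> cmod (f (Suc k)) + cmod z * cmod (c k)"
    by (metis norm_mult norm_triangle_ineq)
  also have "\<dots> \<le> cmod (f (Suc k)) + cmod (c k)"
    using z1 by (simp add: mult_left_le_one_le)
  finally show ?case using Suc by simp
qed (simp add: c_def b_def y0)

lemma l1_bound: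
  assumes "\<And>K. (\<Sum>n<K. cmod (f n)) \<le> C"
  shows "cmod (z - inverse z) * cmod (y k) \<le> 2 * C"
proof -
  have sm: "summable (\<lambda>n. cmod (f n))"
    using assms by (intro summableI_nonneg_bounded) auto
  have "cmod (b 0) \<le> (\<Sum>n. cmod (f (Suc n)))"
    using b_tail_bound[OF sm, of 0] by simp
  also have "\<dots> \<le> (\<Sum>n. cmod (f n))"
    using suminf_split_head[OF sm] by simp
  also have "\<dots> \<le> C"
    using assms by (intro suminf_le_const[OF sm]) auto
  finally have b0: "cmod (b 0) \<le> C" .
  have sm': "summable (\<lambda>n. cmod (f (Suc n)))" using sm by (subst summable_Suc_iff)
  \<comment> \<open>Apart from \<open>b 0\<close>, the bound for \<open>c k\<close> involves the
    forcing up to \<open>k\<close>, and that for \<open>b k\<close> the forcing after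
    \<open>k\<close>. Together they cost one full sum; the second \<open>C\<close> comes from
    \<open>b 0\<close>.\<close>
  have "(\<Sum>i<k. cmod (f (Suc i))) + cmod (b k) \<le> (\<Sum>i<k. cmod (f (Suc i))) + (\<Sum>n. cmod (f (Suc (n + k))))"
    using b_tail_bound[OF sm, of k] by (simp add: add.commute)
  also have "\<dots> = (\<Sum>n. cmod (f (Suc n)))"
    using suminf_split_initial_segment[OF sm', of k] by simp
  also have "\<dots> \<le> (\<Sum>n. cmod (f n))"
    using suminf_split_head[OF sm] by simp
  also have "\<dots> \<le> C"
    using assms by (intro suminf_le_const[OF sm]) auto
  finally have "(\<Sum>i<k. cmod (f (Suc i))) + cmod (b k) \<le> C" .
  moreover have "cmod (z - inverse z) * cmod (y k) = cmod (c k - b k)"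
    by (simp add: c_def b_def norm_mult[symmetric] left_diff_distrib)
  ultimately show ?thesis
    using norm_triangle_ineq4[of "c k" "b k"] c_bound[of k] b0 by linarith
qed

end

section \<open>Rows of the matrix and residue classes modulo p\<close>

text \<open>Identifies \<open>qrow p d n\<close> as the l1 norm, within the band, of row n of D_0 -
  D. Columns of index at most 0 drop out because there the extended matrix coincides with
  D_0.\<close>

lemma qrow_eq_row_sum:
  assumes "p \<ge> 1" "n \<ge> 1"
  shows "qrow p d n = (\<Sum>j\<in>{1..n+p}. if \<bar>int n - int j\<bar> \<le> int p
           then cmod ((if \<bar>int n - int j\<bar> = int p then 1 else 0) - d n j) else 0)"
proof -
  define g where "g r = cmod (ext_entry p d (int n) (int n + r) - (if \<bar>r\<bar> = int p then 1 else 0))" for r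
  have g_row: "g r = cmod ((if \<bar>r\<bar> = int p then 1 else 0) - d n (nat (int n + r)))"
    if "1 \<le> int n + r" for r
    using that assms(2) unfolding g_def ext_entry_def by (subst norm_minus_commute) simp
  have "{- int p..int p} = insert (- int p) (insert (int p) {- int p + 1..int p - 1})"
    using assms by auto
  moreover have "(\<Sum>r\<in>{- int p + 1..int p - 1}. g r)
      = (\<Sum>r = - int p + 1..int p - 1. cmod (ext_entry p d (int n) (int n + r)))"
    by (intro sum.cong) (auto simp: g_def)
  ultimately have "qrow p d n = (\<Sum>r\<in>{- int p..int p}. g r)"
    using assms by (simp add: qrow_def g_def)
  also have "\<dots> = (\<Sum>r\<in>{- int p..int p} \<inter> {r. int n + r \<ge> 1}. g r)"
    using assms by (intro sum.mono_neutral_right) (auto simp: g_def ext_entry_def)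
  also have "\<dots> = (\<Sum>j\<in>{j\<in>{1..n+p}. \<bar>int n - int j\<bar> \<le> int p}.
      cmod ((if \<bar>int n - int j\<bar> = int p then 1 else 0) - d n j))"
    by (rule sum.reindex_bij_witness[of _ "\<lambda>j. int j - int n" "\<lambda>r. nat (int n + r)"])
       (use assms in \<open>auto simp: g_row abs_minus_commute\<close>)
  also have "\<dots> = (\<Sum>j\<in>{1..n+p}. if \<bar>int n - int j\<bar> \<le> int p
           then cmod ((if \<bar>int n - int j\<bar> = int p then 1 else 0) - d n j) else 0)"
    by (rule sum.inter_filter) simp
  finally show ?thesis .
qed

lemma qrow_nonneg: "qrow p d n \<ge> 0"
  by (simp add: qrow_def sum_nonneg)

lemma perturbation_bound:
  assumes "p \<ge> 1" "banded p d" "n \<ge> 1"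
    and eig: "mat_op d x n = w * x n" and x0: "x 0 = 0"
    and M: "\<And>j. cmod (x j) \<le> M"
  shows "cmod (x (n + p) + x (n - p) - w * x n) \<le> qrow p d n * M"
proof -
  define e :: "nat \<Rightarrow> complex" where "e j = (if \<bar>int n - int j\<bar> = int p then 1 else 0)" for j
  have "mat_op d x n = (\<Sum>\<^sub>\<infinity>j\<in>{1..}. d n j * x j)"
    using assms by (simp add: mat_op_def)
  also have "\<dots> = (\<Sum>\<^sub>\<infinity>j\<in>{1..n+p}. d n j * x j)"
    using assms(2,3) by (intro infsum_cong_neutral) (auto simp: banded_def)
  finally have wx: "w * x n = (\<Sum>j\<in>{1..n+p}. d n j * x j)"
    using eig by simp
  have "(\<Sum>j\<in>{1..n+p}. e j * x j) = (\<Sum>j\<in>{0..n+p}. e j * x j)"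
    using x0 by (intro sum.mono_neutral_left) (auto simp: not_less_eq_eq)
  \<comment> \<open>If \<open>n < p\<close>, truncated subtraction turns \<open>n - p\<close> into
    0, and \<open>x 0 = 0\<close> makes that spurious term vanish.\<close>
  also have "\<dots> = (\<Sum>j\<in>{n + p, n - p}. e j * x j)"
    using x0 by (intro sum.mono_neutral_right) (auto simp: e_def)
  also have "\<dots> = x (n + p) + x (n - p)"
    using assms(1,3) x0 by (cases "p \<le> n") (auto simp: e_def)
  finally have "x (n + p) + x (n - p) - w * x n = (\<Sum>j\<in>{1..n+p}. (e j - d n j) * x j)"
    by (simp add: wx sum_subtractf left_diff_distrib)
  then have "cmod (x (n + p) + x (n - p) - w * x n) \<le> (\<Sum>j\<in>{1..n+p}. cmod (e j - d n j) * cmod (x j))"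
    by (simp add: norm_mult[symmetric] norm_sum)
  also have "\<dots> \<le> (\<Sum>j\<in>{1..n+p}. cmod (e j - d n j) * M)"
    by (intro sum_mono mult_left_mono M) auto
  also have "\<dots> = (\<Sum>j\<in>{1..n+p}. if \<bar>int n - int j\<bar> \<le> int p then cmod (e j - d n j) else 0) * M"
    unfolding sum_distrib_right
    by (intro sum.cong) (use assms(2,3) in \<open>auto simp: banded_def e_def\<close>)
  also have "\<dots> = qrow p d n * M"
    unfolding qrow_eq_row_sum[OF assms(1,3)] e_def ..
  finally show ?thesis .
qed

lemma l2_bounded:
  assumes "x \<in> l2"
  shows "bounded (range x)"
proof -
  have s: "(\<lambda>n. (cmod (x n))\<^sup>2) summable_on {1..}" and x0: "x 0 = 0"
    using assms by (auto simp: l2_def)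
  define S where "S = (\<Sum>\<^sub>\<infinity>n\<in>{1..}. (cmod (x n))\<^sup>2)"
  have "cmod (x n) \<le> sqrt S" for n
  proof (cases "n = 0")
    case True
    then show ?thesis using x0 by (simp add: S_def infsum_nonneg)
  next
    case False
    then have "(\<Sum>n\<in>{n}. (cmod (x n))\<^sup>2) \<le> S"
      unfolding S_def by (intro finite_sum_le_infsum s) auto
    then show ?thesis by (simp add: real_le_rsqrt)
  qed
  then show ?thesis by (auto simp: bounded_iff)
qed

text \<open>Since \<open>s < p\<close>, the indices \<open>k * p - s\<close> with
  \<open>k >= 1\<close> are distinct and positive, so they select a subfamily of a nonnegative
  series.\<close>

lemma sum_progression_le_infsum:
  fixes g :: "nat \<Rightarrow> real"
  assumes "p \<ge> 1" "s < p" "g summable_on {1..}" "\<And>n. g n \<ge> 0"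
  shows "(\<Sum>k\<in>{1..<K}. g (k * p - s)) \<le> (\<Sum>\<^sub>\<infinity>n\<in>{1..}. g n)"
proof -
  have le: "s < k * p" if "k \<ge> 1" for k
    using assms(2) mult_le_mono1[OF that, of p] by linarith
  have "inj_on (\<lambda>k. k * p - s) {1..<K}"
  proof (rule inj_onI)
    fix i j assume "i \<in> {1..<K}" "j \<in> {1..<K}" "i * p - s = j * p - s"
    then have "i * p = j * p" using le[of i] le[of j] eq_diff_iff[of s "i * p" "j * p"] by simp
    then show "i = j" using assms(1) by simp
  qed
  then have "(\<Sum>k\<in>{1..<K}. g (k * p - s)) = (\<Sum>n\<in>(\<lambda>k. k * p - s) ` {1..<K}. g n)"
    by (simp add: sum.reindex)
  also have "\<dots> \<le> (\<Sum>\<^sub>\<infinity>n\<in>{1..}. g n)"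
    using assms le by (intro finite_sum_le_infsum) (auto simp: Suc_le_eq)
  finally show ?thesis .
qed

text \<open>Counting down from multiples of \<open>p\<close> makes every class start at index 0:
  \<open>0 * p - s\<close> truncates to 0, so \<open>x 0 = 0\<close> supplies
  \<open>y 0 = 0\<close>. For \<open>k >= 1\<close> nothing is truncated in
  \<open>k * p - s\<close>, as \<open>s < p\<close>.\<close>

lemma residue_class_recurrence:
  fixes z :: complex
  assumes "p \<ge> 1" "z \<noteq> 0" "cmod z < 1" "s < p" "x 0 = 0" "bounded (range x)"
  shows "bounded_recurrence z (\<lambda>k. x (k * p - s))
     (\<lambda>k. if k = 0 then 0
       else x ((k * p - s) + p) + x ((k * p - s) - p) - (z + inverse z) * x (k * p - s))"
proof
  show "bounded (range (\<lambda>k. x (k * p - s)))"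
    using assms(6) by (rule bounded_subset) auto
  fix k
  have "Suc (Suc k) * p - s = (Suc k * p - s) + p" "k * p - s = (Suc k * p - s) - p"
    using assms(4) by auto
  then show "x (Suc (Suc k) * p - s) + x (k * p - s) - (z + inverse z) * x (Suc k * p - s) =
      (if Suc k = 0 then 0 else x (Suc k * p - s + p) + x (Suc k * p - s - p)
         - (z + inverse z) * x (Suc k * p - s))"
    by simp
qed (use assms in auto)

lemma residue_class_index:
  assumes "p \<ge> (1::nat)"
  obtains s k where "s < p" "n = k * p - s"
proof
  \<comment> \<open>\<open>?k\<close> is n/p rounded up, so \<open>?k * p\<close> exceeds
    \<open>n\<close> by less than \<open>p\<close>.\<close>
  let ?k = "(n + p - 1) div p"
  let ?r = "(n + p - 1) mod p"
  have "?r < p" using assms by simp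
  then show "p - 1 - ?r < p" using assms by simp
  have "?k * p + ?r = n + p - 1" by simp
  then show "n = ?k * p - (p - 1 - ?r)" using \<open>?r < p\<close> by linarith
qed

section \<open>Estimates for eigenvectors and eigenvalues\<close>

lemma eigenvector_bounds:
  assumes "p \<ge> 1" "banded p d" "z \<noteq> 0" "cmod z < 1"
    and x: "x \<in> l2" "mat_op d x = seq_scale (z + inverse z) x"
    and M: "\<And>j. cmod (x j) \<le> M"
  shows "qrow p d summable_on {1..} \<Longrightarrow>
           cmod (z - inverse z) * cmod (x n) \<le> 2 * (Q0 p d * M)" (is "?S0 \<Longrightarrow> ?B0")
    and "(\<lambda>k. real k * qrow p d k) summable_on {1..} \<Longrightarrow> cmod (x n) \<le> Q1 p d * M" (is "?S1 \<Longrightarrow> ?B1")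
proof -
  obtain s k where s: "s < p" and n: "n = k * p - s"
    using residue_class_index[OF assms(1)] by metis
  \<comment> \<open>The recurrence leaves \<open>f 0\<close> free; the value 0 lets the sums below
    start at \<open>k = 1\<close>.\<close>
  define f where "f k = (if k = 0 then 0 else
    x ((k * p - s) + p) + x ((k * p - s) - p) - (z + inverse z) * x (k * p - s))" for k
  have x0: "x 0 = 0" using x(1) by (simp add: l2_def)
  interpret bounded_recurrence z "\<lambda>k. x (k * p - s)" f
    unfolding f_def using assms s x0 l2_bounded[OF x(1)]
    by (intro residue_class_recurrence)
  have M0: "M \<ge> 0" using M[of 0] norm_ge_zero order_trans by blast
  \<comment> \<open>The position \<open>k\<close> within the class is at most the position in
    \<open>x\<close>, so the moment weight \<open>k\<close> is dominated by the weight in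
    \<open>Q1\<close>.\<close>
  have le: "k \<le> k * p - s" if "k \<ge> 1" for k
  proof -
    have "k - 1 \<le> (k - 1) * p" using assms(1) by simp
    moreover have "k * p = (k - 1) * p + p" using that by (cases k) auto
    ultimately show ?thesis using s by linarith
  qed
  have f: "cmod (f k) \<le> qrow p d (k * p - s) * M" if "k \<ge> 1" for k
  proof -
    have "1 \<le> k * p - s" using le[OF that] that by linarith
    then show ?thesis
      using perturbation_bound[OF assms(1,2), of "k * p - s" x "z + inverse z" M] x x0 M that
      by (simp add: f_def seq_scale_def)
  qed
  show ?B0 if S: ?S0
  proof -
    have "(\<Sum>k<K. cmod (f k)) \<le> Q0 p d * M" for K
    proof -
      have "(\<Sum>k<K. cmod (f k)) = (\<Sum>k\<in>{1..<K}. cmod (f k))"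
        by (intro sum.mono_neutral_right) (auto simp: f_def)
      also have "\<dots> \<le> (\<Sum>k\<in>{1..<K}. qrow p d (k * p - s)) * M"
        unfolding sum_distrib_right by (intro sum_mono f) auto
      also have "\<dots> \<le> Q0 p d * M"
        unfolding Q0_def using assms s S M0
        by (intro mult_right_mono sum_progression_le_infsum) (auto simp: qrow_nonneg)
      finally show ?thesis .
    qed
    from l1_bound[OF this] show ?thesis by (simp add: n)
  qed
  show ?B1 if S: ?S1
  proof -
    have "(\<Sum>k<K. real k * cmod (f k)) \<le> Q1 p d * M" for K
    proof -
      have "(\<Sum>k<K. real k * cmod (f k)) = (\<Sum>k\<in>{1..<K}. real k * cmod (f k))"
        by (intro sum.mono_neutral_right) auto
      also have "\<dots> \<le> (\<Sum>k\<in>{1..<K}. real (k * p - s) * qrow p d (k * p - s)) * M"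
        unfolding sum_distrib_right mult.assoc
        by (intro sum_mono mult_mono f) (use le in \<open>auto simp del: of_nat_diff\<close>)
      also have "\<dots> \<le> Q1 p d * M"
        unfolding Q1_def using assms s S M0
        by (intro mult_right_mono
              sum_progression_le_infsum[where g = "\<lambda>n. real n * qrow p d n"])
           (auto simp: qrow_nonneg)
      finally show ?thesis .
    qed
    from first_moment_bound[OF this] show ?thesis by (simp add: n)
  qed
qed

text \<open>With \<open>M\<close> the supremum of \<open>cmod (x n)\<close>, taking the supremum
  over \<open>n\<close> in the eigenvector bounds puts \<open>M\<close> on both sides, where
  \<open>M > 0\<close> cancels.\<close>

lemma eigenvalue_necessary:
  assumes "p \<ge> 1" "banded p d" "z \<noteq> 0" "cmod z < 1" "is_eigenvalue d (z + inverse z)"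
  shows "qrow p d summable_on {1..} \<Longrightarrow> cmod (z - inverse z) \<le> 2 * Q0 p d" (is "?S0 \<Longrightarrow> ?B0")
    and "(\<lambda>k. real k * qrow p d k) summable_on {1..} \<Longrightarrow> 1 \<le> Q1 p d" (is "?S1 \<Longrightarrow> ?B1")
proof -
  obtain x where x: "x \<in> l2" "x \<noteq> 0" "mat_op d x = seq_scale (z + inverse z) x"
    using assms(5) by (auto simp: is_eigenvalue_def)
  define M where "M = (SUP n. cmod (x n))"
  have bdd: "bdd_above (range (\<lambda>n. cmod (x n)))"
    using l2_bounded[OF x(1)] by (auto simp: bounded_iff bdd_above_def)
  have M: "cmod (x n) \<le> M" for n
    unfolding M_def by (intro cSUP_upper bdd) auto
  obtain m where "x m \<noteq> 0" using x(2) by (auto simp: fun_eq_iff)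
  then have M0: "M > 0" using M[of m] by (smt (verit) zero_less_norm_iff)
  note bounds = eigenvector_bounds[OF assms(1-4) x(1,3) M]
  show ?B0 if ?S0
  proof (rule ccontr)
    assume "\<not> ?B0"
    then have gt: "2 * Q0 p d < cmod (z - inverse z)" by simp
    \<comment> \<open>Positivity comes from the negated bound and \<open>Q0 p d >= 0\<close>; it
      permits the division that isolates \<open>cmod (x n)\<close> under the supremum.\<close>
    have pos: "cmod (z - inverse z) > 0"
      using gt qrow_nonneg[of p d] by (smt (verit) Q0_def infsum_nonneg)
    have "M \<le> 2 * (Q0 p d * M) / cmod (z - inverse z)"
      unfolding M_def
      by (intro cSUP_least) (use bounds(1)[OF that] pos in \<open>auto simp: field_simps M_def\<close>)
    then have "cmod (z - inverse z) * M \<le> 2 * Q0 p d * M"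
      using pos by (simp add: field_simps)
    then show False using gt M0 by simp
  qed
  show ?B1 if ?S1
  proof -
    have "M \<le> Q1 p d * M"
      unfolding M_def by (intro cSUP_least) (use bounds(2)[OF that] in \<open>auto simp: M_def\<close>)
    then show ?thesis using M0 by simp
  qed
qed

section \<open>Comparison with the constants of the theorem\<close>

lemma t_root_bounds: "0 < t_root" "t_root < 1"
proof -
  have eq: "t_root * exp t_root = 1"
    unfolding t_root_def by (rule theI'[OF t_root_ex1])
  then show pos: "0 < t_root"
    by (metis exp_gt_zero zero_less_mult_pos2 zero_less_one)
  have "t_root * 1 < t_root * exp t_root"
    using pos by (intro mult_strict_left_mono) auto
  then show "t_root < 1" using eq by simp
qed

theorem theorem4p3:
  fixes p :: nat and d :: "nat \<Rightarrow> nat \<Rightarrow> complex"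
  assumes "p \<ge> 1"
    and "banded p d"
    and "qrow p d summable_on {1..}"
    and "qsup p d < 1"
  shows "G_domain p d \<inter> discrete_spectrum d = {} \<and>
    ((\<lambda>k. real k * qrow p d k) summable_on {1..} \<and>
       exp ((2 - qsup p d) / (1 - qsup p d) * Q0 p d) * Q1 p d < t_root / 4
     \<longrightarrow> discrete_spectrum d = {})"
proof -
  define E where "E = exp ((2 - qsup p d) / (1 - qsup p d) * Q0 p d)"
  have Q0: "Q0 p d \<ge> 0" unfolding Q0_def by (intro infsum_nonneg qrow_nonneg)
  have Q1: "Q1 p d \<ge> 0" unfolding Q1_def by (intro infsum_nonneg) (simp add: qrow_nonneg)
  \<comment> \<open>Since q < 1, the fraction (2 - q)/(1 - q) is positive, so the exponent is
    nonnegative.\<close>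
  have E: "E \<ge> 1" using assms(4) Q0 by (simp add: E_def)
  note t = t_root_bounds
  \<comment> \<open>As \<open>2 <= 8 / t_root\<close> and \<open>1 <= E\<close>, the threshold in
    \<open>Omega\<close> is at least the necessary bound \<open>2 * Q0 p d\<close>.\<close>
  have "2 * Q0 p d \<le> 8 * Q0 p d / t_root * E"
  proof -
    have "2 * Q0 p d \<le> 8 * Q0 p d / t_root"
      using t Q0 mult_right_mono[of t_root 4 "Q0 p d"] by (simp add: field_simps)
    also have "\<dots> \<le> 8 * Q0 p d / t_root * E"
      using E Q0 t mult_left_mono[of 1 E "8 * Q0 p d / t_root"] by simp
    finally show ?thesis .
  qed
  then have "\<not> is_eigenvalue d (z + inverse z)" if "z \<in> Omega p d" for z
    using eigenvalue_necessary(1)[OF assms(1,2), of z] assms(3) that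
    by (auto simp: Omega_def E_def)
  then have "G_domain p d \<inter> discrete_spectrum d = {}"
    by (auto simp: G_domain_def discrete_spectrum_def)
  moreover have "discrete_spectrum d = {}"
    if S: "(\<lambda>k. real k * qrow p d k) summable_on {1..}" and lt: "E * Q1 p d < t_root / 4"
  proof (rule ccontr)
    assume "discrete_spectrum d \<noteq> {}"
    then obtain w where w: "w \<notin> complex_of_real ` {-2..2}" "is_eigenvalue d w"
      by (auto simp: discrete_spectrum_def)
    obtain z where "z \<noteq> 0" "cmod z < 1" "w = z + inverse z"
      using Joukowski_preimage[OF w(1)] .
    then have "1 \<le> Q1 p d"
      using eigenvalue_necessary(2)[OF assms(1,2)] S w(2) by blast
    \<comment> \<open>This closes the impossible chain
      \<open>1 <= Q1 p d <= E * Q1 p d < t_root / 4 < 1\<close>.\<close>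
    moreover have "Q1 p d \<le> E * Q1 p d"
      using E Q1 mult_right_mono[of 1 E "Q1 p d"] by simp
    ultimately show False using lt t by linarith
  qed
  ultimately show ?thesis unfolding E_def by blast
qed

end
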